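(* For $n\ge 3$, let $D_{n,1}$ be the random variable that equals $1$ if $1$ is a descent of $s(\sigma)$ and $0$ otherwise, where $\sigma$ is chosen uniformly at random from $S_{n-1}$. Then \[\lim_{n\to\infty}\mathbb E(D_{n,1})=3-e.\]
   Context: $S_n$ is the set of permutations of $\{1,\dots,n\}$ written in one-line notation. An index $i$ is a descent of $\pi=\pi_1\cdots\pi_n$ if $1\le i\le n-1$ and $\pi_i>\pi_{i+1}$. West's stack-sorting map $s$ is defined recursively on permutations of finite sets of positive integers: $s$ of the empty permutation is empty, and if $\pi=LmR$ with $m$ the largest entry of $\pi$, then $s(\pi)=s(L)\,s(R)\,m$. *)

theory Defs
  imports "HOL-Probability.Probability" "HOL-Combinatorics.Combinatorics"
begin

text \<open>
  A permutation of a finite set of positive integers, in one-line notation, is a list without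
  repetitions; those of a given set \<open>A\<close> form \<^term>\<open>permutations_of_set A\<close>.

  For distinct entries, the two lists around the maximum \<open>m\<close> below are exactly the
  \<open>L\<close> and \<open>R\<close> of the decomposition \<open>\<pi> = L m R\<close>; see \<open>stack_sort_decomp\<close>.
\<close>

function stack_sort :: "nat list \<Rightarrow> nat list" where
  "stack_sort [] = []"
| "stack_sort (x # xs) =
    (let m = Max (set (x # xs));
         L = takeWhile (\<lambda>y. y \<noteq> m) (x # xs);
         R = tl (dropWhile (\<lambda>y. y \<noteq> m) (x # xs))
     in stack_sort L @ stack_sort R @ [m])"
  by pat_completeness auto
termination
proof (relation "Wellfounded.measure length", goal_cases)
  case 1
  show ?case by simp
next
  case (2 x xs m L)
  have "m \<in> set (x # xs)"
    using 2(1) Max_in[of "set (x # xs)"] by simp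
  then obtain as bs where "x # xs = as @ m # bs" "m \<notin> set as"
    by (meson split_list_first)
  hence "L = as"
    using 2(2) by (auto simp: takeWhile_append)
  thus ?case
    using \<open>x # xs = as @ m # bs\<close> by (metis add_Suc_right in_measure le_add1 le_imp_less_Suc
        length_append list.size(4) One_nat_def add.commute plus_1_eq_Suc)
next
  case (3 x xs m L R)
  have "length (dropWhile (\<lambda>y. y \<noteq> m) (x # xs)) \<le> length (x # xs)"
    by (rule length_dropWhile_le)
  hence "length R \<le> length xs"
    using 3(3) by simp
  thus ?case by simp
qed

lemma stack_sort_decomp:
  assumes "\<forall>y\<in>set L \<union> set R. y < m"
  shows "stack_sort (L @ m # R) = stack_sort L @ stack_sort R @ [m]"
proof -
  obtain x xs where eq: "L @ m # R = x # xs"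
    by (cases L) auto
  have mx: "Max (set (L @ m # R)) = m"
    using assms by (intro Max_eqI) (auto intro: less_imp_le)
  have tw: "takeWhile (\<lambda>y. y \<noteq> m) (L @ m # R) = L"
    using assms by (subst takeWhile_append2) auto
  have dw: "dropWhile (\<lambda>y. y \<noteq> m) (L @ m # R) = m # R"
    using assms by (subst dropWhile_append2) auto
  show ?thesis
    using mx tw dw unfolding eq stack_sort.simps(2) Let_def by simp
qed

text \<open>Positions of the one-line notation are counted from \<open>1\<close>, list positions from \<open>0\<close>.\<close>

definition is_descent :: "nat list \<Rightarrow> nat \<Rightarrow> bool" where
  "is_descent p i \<longleftrightarrow> 1 \<le> i \<and> i \<le> length p - 1 \<and> p ! (i - 1) > p ! i"

definition uniform_perm :: "nat \<Rightarrow> nat list pmf" where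
  "uniform_perm k = pmf_of_set (permutations_of_set {1..k})"

text \<open>
  The random variable \<open>D\<^sub>n\<^sub>,\<^sub>i\<close> is \<open>sorted_descent i\<close> on the probability space
  \<open>uniform_perm (n - 1)\<close>; the index \<open>n\<close> enters only through that space.
\<close>

definition sorted_descent :: "nat \<Rightarrow> nat list \<Rightarrow> real" where
  "sorted_descent i \<sigma> = (if is_descent (stack_sort \<sigma>) i then 1 else 0)"

end

theory Submission
  imports Defs
begin

text \<open>
  Write \<open>S\<^sub>k\<close> for the sum of \<open>1 / i!\<close> over \<open>i \<le> k\<close>.
  For every \<open>k \<ge> 1\<close> the expectation over the orderings of a \<open>k\<close>-element set is exactly
  \<open>3 - S\<^sub>k - 1 / k!\<close>, and the limit follows.

  To get the exact value, a random ordering of a set with maximum \<open>m\<close> and \<open>M\<close> further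
  entries is produced by inserting \<open>m\<close> into a random ordering \<open>u\<close> of the rest, at a position
  \<open>l\<close> uniform in \<open>0, \<dots>, M\<close> (\<open>perm_mean_insert\<close>). Then the stack-sorted list is
  \<open>s(L) s(R) m\<close>, where \<open>L\<close> consists of the first \<open>l\<close> entries of \<open>u\<close> and \<open>R\<close> of the
  others, and its first two entries are decided as follows.

  \<^item> If \<open>l \<ge> 2\<close>, they are those of \<open>s(L)\<close>; as \<open>L\<close> is a uniformly random ordering of a random
    \<open>l\<close>-subset, this is the same problem of size \<open>l\<close> (\<open>perm_mean_take\<close>).
  \<^item> If \<open>l = 0\<close>, there is a descent iff \<open>s(u)\<close> has one.
  \<^item> If \<open>l = 1\<close>, then \<open>u = a R\<close>, and there is a descent iff \<open>a\<close> exceeds the first entry of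
    \<open>s(R)\<close>.

  The last case needs the probability \<open>a\<^sub>k\<close> of the complementary event for an ordering
  \<open>a R\<close> of \<open>k\<close> elements: \<open>R\<close> is empty or \<open>a\<close> is below the first entry of \<open>s(R)\<close>. The same
  insertion of the maximum settles it: the event fails for \<open>l = 0\<close>, is inherited from \<open>u\<close> for
  \<open>l = 1\<close>, and from \<open>L\<close> for \<open>l \<ge> 2\<close>. Hence
  \<open>k a\<^sub>k = a\<^bsub>k-1\<^esub> + a\<^sub>2 + \<dots> + a\<^bsub>k-1\<^esub>\<close> for \<open>k \<ge> 2\<close>. Subtracting consecutive instances gives
  \<open>k (a\<^sub>k - a\<^bsub>k-1\<^esub>) = a\<^bsub>k-1\<^esub> - a\<^bsub>k-2\<^esub>\<close>, so the differences are \<open>- 1 / k!\<close> and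
  \<open>a\<^sub>k = 3 - S\<^sub>k\<close>: this is where \<open>e\<close> comes from. The descent probabilities \<open>p\<^sub>k\<close> satisfy
  \<open>k p\<^sub>k = p\<^bsub>k-1\<^esub> + (1 - a\<^bsub>k-1\<^esub>) + p\<^sub>2 + \<dots> + p\<^bsub>k-1\<^esub>\<close>, which \<open>3 - S\<^sub>k - 1 / k!\<close> solves.
\<close>

section \<open>Averaging over the orderings of a finite set\<close>

text \<open>
  Sorting depends only on the relative order of the entries. Working with arbitrary sets, and
  proving that means depend only on the cardinality, replaces any relabelling of entries by
  \<open>1, \<dots>, k\<close> when passing to a part of a permutation.
\<close>

definition perm_mean :: "'a set \<Rightarrow> ('a list \<Rightarrow> real) \<Rightarrow> real" where
  "perm_mean A h = (\<Sum>u\<in>permutations_of_set A. h u) / fact (card A)"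

lemma perm_mean_cong:
  assumes "\<And>u. u \<in> permutations_of_set A \<Longrightarrow> h u = h' u"
  shows "perm_mean A h = perm_mean A h'"
  unfolding perm_mean_def using assms by (simp cong: sum.cong)

lemma perm_mean_const:
  assumes "finite A"
  shows "perm_mean A (\<lambda>_. c) = c"
  using assms by (simp add: perm_mean_def)

lemma perm_mean_diff:
  "perm_mean A (\<lambda>u. h u - h' u) = perm_mean A h - perm_mean A h'"
  by (simp add: perm_mean_def sum_subtractf diff_divide_distrib)

lemma length_permutations_of_set:
  assumes "u \<in> permutations_of_set A"
  shows "length u = card A"
  using assms by (auto simp: permutations_of_set_def distinct_card)

text \<open>
  Deleting \<open>m\<close> from an ordering of \<open>insert m A\<close> and recording its position is a bijection onto
  pairs of a position and an ordering of \<open>A\<close>.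
\<close>

lemma perm_mean_insert:
  assumes "finite A" "m \<notin> A"
  shows "perm_mean (insert m A) h =
    (\<Sum>l\<le>card A. perm_mean A (\<lambda>u. h (take l u @ m # drop l u))) / real (Suc (card A))"
proof -
  let ?f = "\<lambda>(l, u). take l u @ m # drop l u"
  let ?P = "{..card A} \<times> permutations_of_set A"
  have inj: "inj_on ?f ?P"
  proof (rule inj_onI)
    fix p p'
    assume p: "p \<in> ?P" "p' \<in> ?P" "?f p = ?f p'"
    obtain l u l' u' where pu: "p = (l, u)" "p' = (l', u')"
      by (cases p, cases p') auto
    have l: "l \<in> {..card A}" "l' \<in> {..card A}"
      and u: "u \<in> permutations_of_set A" "u' \<in> permutations_of_set A"
      and eq: "take l u @ m # drop l u = take l' u' @ m # drop l' u'"
      using p unfolding pu by simp_all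
    have "m \<notin> set (take l u)" "m \<notin> set (drop l u)" "m \<notin> set (take l' u')"
      using u assms(2) by (auto dest: permutations_of_setD(1) in_set_takeD in_set_dropD)
    hence parts: "take l u = take l' u'" "drop l u = drop l' u'"
      using eq by (metis append_Cons_eq_iff)+
    hence "u = u'"
      by (metis append_take_drop_id)
    moreover have "l = l'"
      using arg_cong[OF parts(1), of length] l u
      by (simp add: length_permutations_of_set min_def split: if_splits)
    ultimately show "p = p'"
      by (simp add: pu)
  qed
  have img: "?f ` ?P = permutations_of_set (insert m A)"
  proof (intro equalityI subsetI)
    fix w assume "w \<in> ?f ` ?P"
    then obtain l u where w: "w = take l u @ m # drop l u" and u: "u \<in> permutations_of_set A"
      by auto
    have "set (take l u) \<union> set (drop l u) = A"
      using u by (simp add: permutations_of_set_def flip: set_append)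
    moreover have "distinct u"
      using u by (simp add: permutations_of_set_def)
    hence "set (take l u) \<inter> set (drop l u) = {}" "distinct (take l u)" "distinct (drop l u)"
      by (simp_all add: set_take_disj_set_drop_if_distinct)
    ultimately show "w \<in> permutations_of_set (insert m A)"
      using assms(2) unfolding w permutations_of_set_def by auto
  next
    fix w assume w: "w \<in> permutations_of_set (insert m A)"
    hence "m \<in> set w"
      by (simp add: permutations_of_set_def)
    then obtain L R where LR: "w = L @ m # R"
      by (meson split_list)
    have "L @ R \<in> permutations_of_set A"
      using w assms(2) unfolding LR permutations_of_set_def by auto
    moreover have "length L \<le> card A"
      using length_permutations_of_set[OF calculation] by simp
    moreover have "w = ?f (length L, L @ R)"
      by (simp add: LR)
    ultimately show "w \<in> ?f ` ?P"
      by (metis (no_types, lifting) SigmaI atMost_iff imageI)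
  qed
  have "(\<Sum>w\<in>permutations_of_set (insert m A). h w) = (\<Sum>x\<in>?P. h (?f x))"
    using sum.reindex[OF inj, of h] unfolding img by simp
  also have "\<dots> = (\<Sum>l\<le>card A. \<Sum>u\<in>permutations_of_set A. h (take l u @ m # drop l u))"
    by (simp add: sum.cartesian_product case_prod_unfold)
  finally show ?thesis
    using assms by (simp add: perm_mean_def sum_divide_distrib field_simps)
qed

text \<open>
  Conditioning on the last entry; used to shorten a list to a prefix one entry at a time.
\<close>

lemma perm_mean_split_last:
  assumes "finite A" "A \<noteq> {}"
  shows "perm_mean A h =
    (\<Sum>x\<in>A. perm_mean (A - {x}) (\<lambda>u. h (u @ [x]))) / real (card A)"
proof -
  let ?f = "\<lambda>(x, u). u @ [x]"
  let ?P = "SIGMA x:A. permutations_of_set (A - {x})"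
  have inj: "inj_on ?f ?P"
    by (auto simp: inj_on_def)
  have img: "?f ` ?P = permutations_of_set A"
  proof (intro equalityI subsetI)
    fix w assume "w \<in> ?f ` ?P"
    then obtain x u where w: "w = u @ [x]" and x: "x \<in> A"
      and u: "u \<in> permutations_of_set (A - {x})"
      by auto
    have "set w = A"
      using permutations_of_setD(1)[OF u] insert_Diff[OF x] by (simp add: w)
    moreover have "distinct w"
      using permutations_of_setD[OF u] by (simp add: w)
    ultimately show "w \<in> permutations_of_set A"
      by (rule permutations_of_setI)
  next
    fix w assume w: "w \<in> permutations_of_set A"
    hence "w \<noteq> []"
      using assms(2) by (auto simp: permutations_of_set_def)
    then obtain u x where ux: "w = u @ [x]"
      by (metis rev_exhaust)
    have "(x, u) \<in> ?P"
      using w unfolding ux permutations_of_set_def by auto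
    thus "w \<in> ?f ` ?P"
      by (rule rev_image_eqI) (simp add: ux)
  qed
  have "(\<Sum>w\<in>permutations_of_set A. h w) = (\<Sum>x\<in>?P. h (?f x))"
    using sum.reindex[OF inj, of h] unfolding img by simp
  also have "\<dots> = (\<Sum>x\<in>A. \<Sum>u\<in>permutations_of_set (A - {x}). h (u @ [x]))"
    using assms by (subst sum.Sigma) (auto simp: case_prod_unfold)
  also have "\<dots> = (\<Sum>x\<in>A. fact (card A - 1) * perm_mean (A - {x}) (\<lambda>u. h (u @ [x])))"
    using assms by (intro sum.cong) (simp_all add: perm_mean_def)
  also have "\<dots> = fact (card A - 1) * (\<Sum>x\<in>A. perm_mean (A - {x}) (\<lambda>u. h (u @ [x])))"
    by (simp add: sum_distrib_left)
  finally show ?thesis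
    using assms fact_reduce[of "card A", where ?'a = real]
    by (simp add: perm_mean_def card_gt_0_iff field_simps)
qed

text \<open>
  A prefix of length \<open>l\<close> of a random ordering is a random ordering of a random \<open>l\<close>-subset. Hence a
  statistic whose mean \<open>c\<close> is the same for all \<open>l\<close>-subsets has mean \<open>c\<close> on prefixes. The
  induction deletes the last entry of the ordering until only the prefix is left.
\<close>

lemma perm_mean_take:
  assumes "finite A" "l \<le> card A"
    and "\<And>B. B \<subseteq> A \<Longrightarrow> card B = l \<Longrightarrow> perm_mean B h = c"
  shows "perm_mean A (\<lambda>u. h (take l u)) = c"
  using assms
proof (induction "card A - l" arbitrary: A)
  case 0
  hence "perm_mean A (\<lambda>u. h (take l u)) = perm_mean A h"
    by (intro perm_mean_cong) (simp add: length_permutations_of_set)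
  thus ?case
    using 0 by simp
next
  case (Suc d)
  hence ne: "A \<noteq> {}"
    by auto
  have "perm_mean (A - {x}) (\<lambda>u. h (take l (u @ [x]))) = c" if x: "x \<in> A" for x
  proof -
    have card: "card (A - {x}) = card A - 1"
      using x Suc.prems(1) by simp
    have "perm_mean (A - {x}) (\<lambda>u. h (take l (u @ [x])))
        = perm_mean (A - {x}) (\<lambda>u. h (take l u))"
      using Suc.hyps(2) card by (intro perm_mean_cong) (simp add: length_permutations_of_set)
    also have "\<dots> = c"
      using Suc.hyps(2) Suc.prems card by (intro Suc.hyps(1)) auto
    finally show ?thesis .
  qed
  thus ?case
    using Suc.prems(1) ne by (subst perm_mean_split_last) simp_all
qed

section \<open>The start of a stack-sorted list\<close>

text \<open>
  The defining equation has a left-hand side that matches recursive calls on lists whose entries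
  are unknown, so it is unsuitable for rewriting; \<open>stack_sort_decomp\<close> is used instead.
\<close>

declare stack_sort.simps(2) [simp del]

lemma set_stack_sort [simp]: "set (stack_sort xs) = set xs"
proof (induction xs rule: length_induct)
  case (1 xs)
  show ?case
  proof (cases "xs = []")
    case False
    define m where "m = Max (set xs)"
    have "m \<in> set xs"
      using False by (simp add: m_def)
    then obtain L R where LR: "xs = L @ m # R" "m \<notin> set L"
      by (meson split_list_first)
    have tw: "takeWhile (\<lambda>y. y \<noteq> m) xs = L"
      using LR by (auto simp: takeWhile_append)
    have dw: "dropWhile (\<lambda>y. y \<noteq> m) xs = m # R"
      unfolding LR(1) using LR(2) by (subst dropWhile_append2) auto
    obtain y ys where xs: "xs = y # ys"
      using False by (cases xs) auto
    have "stack_sort xs = stack_sort L @ stack_sort R @ [m]"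
      using tw dw m_def unfolding xs stack_sort.simps(2) Let_def by simp
    thus ?thesis
      using 1 LR(1) by auto
  qed simp
qed

lemma stack_sort_eq_Nil_iff [simp]: "stack_sort xs = [] \<longleftrightarrow> xs = []"
  by (metis set_empty set_stack_sort)

lemma stack_sort_singleton [simp]: "stack_sort [a] = [a]"
  using stack_sort_decomp[of "[]" "[]" a] by simp

text \<open>
  The event behind \<open>a\<^sub>k\<close> in the introduction. A singleton counts as satisfying it, so that for
  an ordering \<open>a R\<close> the complement is precisely a descent at the start of \<open>s(a m R) = a s(R) m\<close>,
  where \<open>m\<close> is the maximum, also when \<open>R\<close> is empty.
\<close>

definition head_below_sorted_tail :: "nat list \<Rightarrow> real" where
  "head_below_sorted_tail w = of_bool (tl w = [] \<or> hd w < hd (stack_sort (tl w)))"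

lemma length_stack_sort_ge_2:
  assumes "distinct xs" "2 \<le> length xs"
  shows "2 \<le> length (stack_sort xs)"
proof -
  have "2 \<le> card (set (stack_sort xs))"
    using assms by (simp add: distinct_card)
  thus ?thesis
    using card_length order_trans by blast
qed

lemma sorted_descent_append:
  assumes "2 \<le> length (stack_sort u)" "stack_sort w = stack_sort u @ v"
  shows "sorted_descent 1 w = sorted_descent 1 u"
  using assms by (auto simp: sorted_descent_def is_descent_def nth_append)

text \<open>
  With the maximum in front, the head is too large. With the maximum second, sorting the tail
  moves it to the end, where it matters only if nothing else is left, and then it exceeds the head.
  With the maximum further right, the sorted tail begins with the sorted entries between the head
  and the maximum.
\<close>

lemma head_below_sorted_tail_insert_max:
  assumes "distinct u" "\<forall>y\<in>set u. y < m" "u \<noteq> []" "l \<le> length u"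
  shows "head_below_sorted_tail (take l u @ m # drop l u) =
    (if l = 0 then 0 else if l = 1 then head_below_sorted_tail u
     else head_below_sorted_tail (take l u))"
proof -
  obtain a v where u: "u = a # v"
    using assms(3) by (cases u) auto
  consider "l = 0" | "l = 1" | k where "l = Suc k" "k > 0"
    by (cases l) auto
  thus ?thesis
  proof cases
    case 1
    have "hd (stack_sort u) \<in> set u"
      using assms(3) by (metis hd_in_set set_stack_sort stack_sort_eq_Nil_iff)
    with 1 assms show ?thesis
      by (auto simp: head_below_sorted_tail_def)
  next
    case 2
    have "stack_sort (m # v) = stack_sort v @ [m]"
      using stack_sort_decomp[of "[]" v m] assms u by simp
    with 2 assms u show ?thesis
      by (auto simp: head_below_sorted_tail_def hd_append)
  next
    case 3
    have "stack_sort (take k v @ m # drop k v)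
        = stack_sort (take k v) @ stack_sort (drop k v) @ [m]"
      using assms u by (intro stack_sort_decomp) (auto dest!: in_set_takeD in_set_dropD)
    moreover have "take k v \<noteq> []"
      using 3 assms u by auto
    ultimately show ?thesis
      using 3 u by (simp add: head_below_sorted_tail_def hd_append)
  qed
qed

text \<open>
  The three cases of the introduction. For \<open>l = 1\<close> distinctness turns the failure of
  \<open>a < hd (stack_sort R)\<close> into a strict descent.
\<close>

lemma sorted_descent_insert_max:
  assumes "distinct u" "\<forall>y\<in>set u. y < m" "u \<noteq> []" "l \<le> length u"
  shows "sorted_descent 1 (take l u @ m # drop l u) =
    (if l = 0 then sorted_descent 1 u else if l = 1 then 1 - head_below_sorted_tail u
     else sorted_descent 1 (take l u))"
proof -
  have decomp: "stack_sort (take l u @ m # drop l u)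
      = stack_sort (take l u) @ stack_sort (drop l u) @ [m]"
    using assms by (intro stack_sort_decomp) (auto dest!: in_set_takeD in_set_dropD)
  obtain a v where u: "u = a # v"
    using assms(3) by (cases u) auto
  consider "l = 0" | "l = 1" | "l \<ge> 2"
    by linarith
  thus ?thesis
  proof cases
    case 1
    show ?thesis
    proof (cases "v = []")
      case True
      have "stack_sort [m, a] = [a, m]"
        using decomp 1 u True by simp
      thus ?thesis
        using 1 u True assms by (simp add: sorted_descent_def is_descent_def)
    next
      case False
      hence "2 \<le> length (stack_sort u)"
        using assms u by (intro length_stack_sort_ge_2) (cases v; simp)+
      hence "sorted_descent 1 (take l u @ m # drop l u) = sorted_descent 1 u"
        by (rule sorted_descent_append) (use decomp 1 in simp)
      thus ?thesis
        using 1 by simp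
    qed
  next
    case 2
    hence eq: "stack_sort (a # m # v) = a # stack_sort v @ [m]"
      using decomp u by simp
    show ?thesis
    proof (cases "v = []")
      case True
      thus ?thesis
        using 2 eq u assms
        by (simp add: sorted_descent_def is_descent_def head_below_sorted_tail_def)
    next
      case False
      then obtain b bs where b: "stack_sort v = b # bs"
        by (metis list.exhaust stack_sort_eq_Nil_iff)
      have "b \<in> set v"
        by (metis b list.set_intros(1) set_stack_sort)
      hence "b \<noteq> a"
        using assms u by auto
      thus ?thesis
        using 2 eq u b False
        by (auto simp: sorted_descent_def is_descent_def head_below_sorted_tail_def)
    qed
  next
    case 3
    hence "2 \<le> length (stack_sort (take l u))"
      using assms by (intro length_stack_sort_ge_2) simp_all
    hence "sorted_descent 1 (take l u @ m # drop l u) = sorted_descent 1 (take l u)"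
      using decomp by (rule sorted_descent_append)
    thus ?thesis
      using 3 by simp
  qed
qed

section \<open>The exact expectations\<close>

lemma sum_atMost_split_two:
  fixes f :: "nat \<Rightarrow> real"
  assumes "1 \<le> M"
  shows "(\<Sum>l\<le>M. f l) = f 0 + f 1 + (\<Sum>l=2..M. f l)"
proof -
  have "{..M} = insert 0 (insert 1 {2..M})"
    using assms by auto
  thus ?thesis
    by simp
qed

definition exp_partial :: "nat \<Rightarrow> real" where
  "exp_partial k = (\<Sum>i\<le>k. 1 / fact i)"

lemma exp_partial_Suc: "exp_partial (Suc k) = exp_partial k + 1 / fact (Suc k)"
  by (simp add: exp_partial_def)

lemma exp_partial_0: "exp_partial 0 = 1"
  by (simp add: exp_partial_def)

lemma Suc_times_inverse_fact_Suc: "real (Suc k) * (1 / fact (Suc k)) = 1 / fact k"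
  by simp

lemma exp_partial_tendsto: "exp_partial \<longlonglongrightarrow> exp 1"
proof -
  have "(\<lambda>i. 1 / fact i :: real) sums exp 1"
    using exp_converges[of "1::real"] by (simp add: divide_inverse)
  thus ?thesis
    unfolding exp_partial_def[abs_def] by (simp add: sums_def_le)
qed

text \<open>
  The recursion for \<open>a\<^sub>k\<close> at \<open>k = M + 1\<close>, with \<open>3 - S\<^sub>l\<close> in place of \<open>a\<^sub>l\<close>.
\<close>

lemma exp_partial_sum:
  assumes "1 \<le> M"
  shows "(\<Sum>l=2..M. 3 - exp_partial l)
    = real (Suc M) * (3 - exp_partial (Suc M)) - (3 - exp_partial M)"
  using assms
proof (induction M rule: nat_induct_at_least)
  case base
  show ?case
    by (simp add: exp_partial_Suc exp_partial_0)
next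
  case (Suc M)
  hence "(\<Sum>l=2..Suc M. 3 - exp_partial l)
      = (\<Sum>l=2..M. 3 - exp_partial l) + (3 - exp_partial (Suc M))"
    by simp
  also have "\<dots> = real (Suc (Suc M)) * (3 - exp_partial (Suc (Suc M)))
      - (3 - exp_partial (Suc M))"
  proof -
    define x :: real where "x = 1 / fact (Suc M)"
    define y :: real where "y = 1 / fact (Suc (Suc M))"
    have "real (Suc (Suc M)) * y = x"
      unfolding x_def y_def by (rule Suc_times_inverse_fact_Suc)
    moreover have "exp_partial (Suc M) = exp_partial M + x"
      "exp_partial (Suc (Suc M)) = exp_partial M + x + y"
      unfolding x_def y_def by (simp_all only: exp_partial_Suc)
    ultimately show ?thesis
      unfolding Suc.IH by (simp add: algebra_simps)
  qed
  finally show ?case .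
qed

text \<open>
  The recursion for \<open>p\<^sub>k\<close> at \<open>k = M + 1\<close>, with \<open>3 - S\<^sub>l - 1 / l!\<close> in place of \<open>p\<^sub>l\<close>. The
  contributions of \<open>l = 0\<close> and \<open>l = 1\<close> add up to \<open>p\<^sub>M + (1 - a\<^sub>M) = 1 - 1 / M!\<close>, the
  subtracted term.
\<close>

lemma exp_partial_descent_sum:
  assumes "1 \<le> M"
  shows "(\<Sum>l=2..M. 3 - exp_partial l - 1 / fact l)
    = real (Suc M) * (3 - exp_partial (Suc M) - 1 / fact (Suc M)) - (1 - 1 / fact M)"
  using assms
proof (induction M rule: nat_induct_at_least)
  case base
  show ?case
    by (simp add: exp_partial_Suc exp_partial_0)
next
  case (Suc M)
  hence "(\<Sum>l=2..Suc M. 3 - exp_partial l - 1 / fact l)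
      = (\<Sum>l=2..M. 3 - exp_partial l - 1 / fact l) + (3 - exp_partial (Suc M) - 1 / fact (Suc M))"
    by simp
  also have "\<dots> = real (Suc (Suc M)) * (3 - exp_partial (Suc (Suc M)) - 1 / fact (Suc (Suc M)))
      - (1 - 1 / fact (Suc M))"
  proof -
    define x :: real where "x = 1 / fact (Suc M)"
    define y :: real where "y = 1 / fact (Suc (Suc M))"
    have "real (Suc (Suc M)) * y = x" "1 / fact M = real (Suc M) * x"
      unfolding x_def y_def by (simp_all only: Suc_times_inverse_fact_Suc)
    moreover have "exp_partial (Suc (Suc M)) = exp_partial (Suc M) + y"
      unfolding y_def by (simp only: exp_partial_Suc)
    ultimately show ?thesis
      unfolding Suc.IH x_def[symmetric] y_def[symmetric] by (simp add: algebra_simps)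
  qed
  finally show ?case .
qed

lemma remove_Max:
  fixes A :: "nat set"
  assumes "finite A" "card A = Suc M"
  obtains m B where "A = insert m B" "finite B" "m \<notin> B" "card B = M" "\<forall>y\<in>B. y < m"
proof
  have ne: "A \<noteq> {}"
    using assms(2) by auto
  show "A = insert (Max A) (A - {Max A})"
    using Max_in[OF assms(1) ne] by auto
  show "card (A - {Max A}) = M"
    using assms ne by simp
  show "\<forall>y\<in>A - {Max A}. y < Max A"
    using assms(1) by (auto simp: less_le)
qed (use assms in auto)

text \<open>
  The induction ranges over all sets of smaller size because the prefixes for \<open>l \<ge> 2\<close> are
  orderings of arbitrary \<open>l\<close>-subsets.
\<close>

lemma perm_mean_head_below_sorted_tail:
  assumes "finite A" "card A = k" "1 \<le> k"
  shows "perm_mean A head_below_sorted_tail = 3 - exp_partial k"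
  using assms
proof (induction k arbitrary: A rule: less_induct)
  case (less k)
  show ?case
  proof (cases "k = 1")
    case True
    then obtain a where "A = {a}"
      using less.prems by (auto simp: card_1_singleton_iff)
    thus ?thesis
      using True by (simp add: perm_mean_def head_below_sorted_tail_def exp_partial_Suc exp_partial_0)
  next
    case False
    then obtain M where k: "k = Suc M" and M: "1 \<le> M"
      using less.prems by (cases k) auto
    obtain m B where B: "A = insert m B" "finite B" "m \<notin> B" "card B = M" "\<forall>y\<in>B. y < m"
      using remove_Max[of A M] less.prems k by blast
    let ?t = "\<lambda>l. perm_mean B (\<lambda>u. head_below_sorted_tail (take l u @ m # drop l u))"
    have ins: "?t l = perm_mean B (\<lambda>u. if l = 0 then 0 else if l = 1
        then head_below_sorted_tail u else head_below_sorted_tail (take l u))" if "l \<le> M" for l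
      using that B M
      by (intro perm_mean_cong head_below_sorted_tail_insert_max)
        (auto simp: length_permutations_of_set dest: permutations_of_setD)
    have t0: "?t 0 = 0"
      using ins[of 0] B by (simp add: perm_mean_const)
    have t1: "?t 1 = 3 - exp_partial M"
      using ins[of 1] M less.IH[of M B] B k by simp
    have t2: "?t l = 3 - exp_partial l" if "l \<in> {2..M}" for l
    proof -
      have "?t l = perm_mean B (\<lambda>u. head_below_sorted_tail (take l u))"
        using ins[of l] that by simp
      also have "\<dots> = 3 - exp_partial l"
        using that B k by (intro perm_mean_take less.IH) (auto intro: finite_subset)
      finally show ?thesis .
    qed
    have "(\<Sum>l\<le>M. ?t l) = ?t 0 + ?t 1 + (\<Sum>l=2..M. ?t l)"
      by (rule sum_atMost_split_two[OF M])
    also have "(\<Sum>l=2..M. ?t l) = (\<Sum>l=2..M. 3 - exp_partial l)"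
      by (intro sum.cong refl t2)
    also have "?t 0 + ?t 1 + \<dots> = 3 - exp_partial M + (\<Sum>l=2..M. 3 - exp_partial l)"
      unfolding t0 t1 by simp
    also have "\<dots> = real (Suc M) * (3 - exp_partial k)"
      unfolding k exp_partial_sum[OF M] by simp
    finally show ?thesis
      unfolding B(1) perm_mean_insert[OF B(2,3)] B(4) by simp
  qed
qed

lemma perm_mean_sorted_descent:
  assumes "finite A" "card A = k" "1 \<le> k"
  shows "perm_mean A (sorted_descent 1) = 3 - exp_partial k - 1 / fact k"
  using assms
proof (induction k arbitrary: A rule: less_induct)
  case (less k)
  show ?case
  proof (cases "k = 1")
    case True
    then obtain a where "A = {a}"
      using less.prems by (auto simp: card_1_singleton_iff)
    thus ?thesis
      using True by (simp add: perm_mean_def sorted_descent_def is_descent_def exp_partial_Suc exp_partial_0)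
  next
    case False
    then obtain M where k: "k = Suc M" and M: "1 \<le> M"
      using less.prems by (cases k) auto
    obtain m B where B: "A = insert m B" "finite B" "m \<notin> B" "card B = M" "\<forall>y\<in>B. y < m"
      using remove_Max[of A M] less.prems k by blast
    let ?t = "\<lambda>l. perm_mean B (\<lambda>u. sorted_descent 1 (take l u @ m # drop l u))"
    have ins: "?t l = perm_mean B (\<lambda>u. if l = 0 then sorted_descent 1 u else if l = 1
        then 1 - head_below_sorted_tail u else sorted_descent 1 (take l u))" if "l \<le> M" for l
      using that B M
      by (intro perm_mean_cong sorted_descent_insert_max)
        (auto simp: length_permutations_of_set dest: permutations_of_setD)
    have t0: "?t 0 = 3 - exp_partial M - 1 / fact M"
      using ins[of 0] M less.IH[of M B] B k by simp
    have t1: "?t 1 = 1 - (3 - exp_partial M)"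
      using ins[of 1] M perm_mean_head_below_sorted_tail[of B M] B
      by (simp add: perm_mean_diff perm_mean_const)
    have t2: "?t l = 3 - exp_partial l - 1 / fact l" if "l \<in> {2..M}" for l
    proof -
      have "?t l = perm_mean B (\<lambda>u. sorted_descent 1 (take l u))"
        using ins[of l] that by simp
      also have "\<dots> = 3 - exp_partial l - 1 / fact l"
        using that B k by (intro perm_mean_take less.IH) (auto intro: finite_subset)
      finally show ?thesis .
    qed
    have "(\<Sum>l\<le>M. ?t l) = ?t 0 + ?t 1 + (\<Sum>l=2..M. ?t l)"
      by (rule sum_atMost_split_two[OF M])
    also have "(\<Sum>l=2..M. ?t l) = (\<Sum>l=2..M. 3 - exp_partial l - 1 / fact l)"
      by (intro sum.cong refl t2)
    also have "?t 0 + ?t 1 + \<dots> = 1 - 1 / fact M + (\<Sum>l=2..M. 3 - exp_partial l - 1 / fact l)"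
      unfolding t0 t1 by simp
    also have "\<dots> = real (Suc M) * (3 - exp_partial k - 1 / fact k)"
      unfolding k exp_partial_descent_sum[OF M] by simp
    finally show ?thesis
      unfolding B(1) perm_mean_insert[OF B(2,3)] B(4) by simp
  qed
qed

lemma expectation_sorted_descent:
  assumes "1 \<le> k"
  shows "measure_pmf.expectation (uniform_perm k) (sorted_descent 1)
    = 3 - exp_partial k - 1 / fact k"
proof -
  have "measure_pmf.expectation (uniform_perm k) (sorted_descent 1)
      = perm_mean {1..k} (sorted_descent 1)"
    unfolding uniform_perm_def perm_mean_def
    by (subst integral_pmf_of_set) (auto simp: permutations_of_set_empty_iff)
  thus ?thesis
    using perm_mean_sorted_descent[of "{1..k}" k] assms by simp
qed

theorem theorem7p12:
  shows "(\<lambda>n::nat. measure_pmf.expectation (uniform_perm (n - 1)) (sorted_descent 1))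
           \<longlonglongrightarrow> 3 - exp 1"
proof -
  have "(\<lambda>k. 1 / fact k :: real) \<longlonglongrightarrow> 0"
    using summable_LIMSEQ_zero[OF summable_exp[of "1::real"]] by (simp add: divide_inverse)
  hence "(\<lambda>k. 3 - exp_partial k - 1 / fact k) \<longlonglongrightarrow> 3 - exp 1 - 0"
    by (intro tendsto_intros exp_partial_tendsto)
  hence "(\<lambda>k. 3 - exp_partial (Suc k) - 1 / fact (Suc k)) \<longlonglongrightarrow> 3 - exp 1"
    by (intro LIMSEQ_Suc) simp
  hence "(\<lambda>k. measure_pmf.expectation (uniform_perm (Suc k)) (sorted_descent 1))
      \<longlonglongrightarrow> 3 - exp 1"
    by (subst expectation_sorted_descent) simp_all
  \<comment> \<open>Sizes \<open>n - 1\<close> are covered by the exact formula from \<open>n = 2\<close> on, hence the shift by two.\<close>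
  hence "(\<lambda>k. measure_pmf.expectation (uniform_perm (k + 2 - 1)) (sorted_descent 1))
      \<longlonglongrightarrow> 3 - exp 1"
    by simp
  thus ?thesis
    by (rule LIMSEQ_offset)
qed

end
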